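(* Let $n$ be a positive integer such that $2^6\mid n$ or $p^5\mid n$ for some odd prime $p$. Then there exists a group $G$ of order $n$ such that $B_0(G)\ne0$.
   Context: For a finite group $G$, the Bogomolov multiplier is $B_0(G)=\bigcap_A\mathrm{Ker}\{\mathrm{res}:H^2(G,\mathbb{Q}/\mathbb{Z})\to H^2(A,\mathbb{Q}/\mathbb{Z})\}$, where $A$ runs over all bicyclic subgroups of $G$ (cyclic groups or direct products of two cyclic groups). *)

theory Defs
  imports "HOL-Algebra.Algebra" "HOL-Computational_Algebra.Primes"
begin

(* H^2(G, Q/Z) with trivial action via inhomogeneous 2-cochains.
   A Q/Z-valued function is represented by a rat-valued lift; equality in Q/Z
   means the difference lies in \<int>. *)

definition cocycle2 :: "('a, 'b) monoid_scheme \<Rightarrow> ('a \<Rightarrow> 'a \<Rightarrow> rat) \<Rightarrow> bool" where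
  "cocycle2 G f \<longleftrightarrow>
     (\<forall>g\<in>carrier G. \<forall>h\<in>carrier G. \<forall>k\<in>carrier G.
        f g h + f (g \<otimes>\<^bsub>G\<^esub> h) k - f g (h \<otimes>\<^bsub>G\<^esub> k) - f h k \<in> \<int>)"

definition coboundary2_on :: "('a, 'b) monoid_scheme \<Rightarrow> 'a set \<Rightarrow> ('a \<Rightarrow> 'a \<Rightarrow> rat) \<Rightarrow> bool" where
  "coboundary2_on G S f \<longleftrightarrow>
     (\<exists>c :: 'a \<Rightarrow> rat. \<forall>g\<in>S. \<forall>h\<in>S.
        f g h - (c g + c h - c (g \<otimes>\<^bsub>G\<^esub> h)) \<in> \<int>)"

(* bicyclic subgroup: cyclic or a direct product of two cyclic groups, i.e.
   an abelian subgroup generated by (at most) two elements *)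
definition bicyclic_subgroup :: "('a, 'b) monoid_scheme \<Rightarrow> 'a set \<Rightarrow> bool" where
  "bicyclic_subgroup G A \<longleftrightarrow>
     subgroup A G \<and>
     (\<forall>x\<in>A. \<forall>y\<in>A. x \<otimes>\<^bsub>G\<^esub> y = y \<otimes>\<^bsub>G\<^esub> x) \<and>
     (\<exists>a\<in>carrier G. \<exists>b\<in>carrier G. A = generate G {a, b})"

definition bogomolov_nontrivial :: "('a, 'b) monoid_scheme \<Rightarrow> bool" where
  "bogomolov_nontrivial G \<longleftrightarrow>
     (\<exists>f. cocycle2 G f \<and> \<not> coboundary2_on G (carrier G) f \<and>
          (\<forall>A. bicyclic_subgroup G A \<longrightarrow> coboundary2_on G A f))"

end

(* A class in H^2(G, Q/Z) with values in (1/p)Z/Z is the pullback of a central extension E of G by Z/p.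
   It lies in B_0(G) as soon as commuting pairs of G lift to commuting pairs of E, and it is
   nontrivial if Z/p is contained in [E, E]. In each case below, one central element z of G is
   a commutator in two ways, z = [x, y] = [u, v], whose lifts to E differ by a generator of Z/p. The
   cocycle is inflated from a Heisenberg group modulo p (for p odd) or from C_2 x C_2 (for p = 2),
   where it becomes an explicit coboundary on the image of every commutative subset of G.
   A direct factor C_k then adjusts the order of G to a given multiple. *)
theory Submission
  imports Defs "HOL-Number_Theory.Cong"
begin

text \<open>On the Heisenberg group with coordinates \<open>t\<close>, \<open>b\<close>,
  \<open>c\<close>, the cocycle \<open>F\<close> of \<open>heisenberg_criterion\<close> is not in
  B_0: the directions \<open>b\<close> and \<open>c\<close> commute there, but \<open>F\<close> is
  alternating and nonzero on them. Making their commutator a new central element z removes this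
  defect; the central extension by \<open>F\<close> alone, however, would turn \<open>F\<close> into
  a coboundary. So a fourth coordinate is put between \<open>c\<close> and z (\<open>d\<close> for p
  > 3). Its commutator with \<open>t\<close> also gives z, which keeps the class nontrivial, and
  commutation in that coordinate makes \<open>c\<close> a function of \<open>t\<close> on
  commutative subsets where \<open>t\<close> is not identically zero modulo p. This explains the
  exponent 5. For p = 3 the coefficient 3 between \<open>d\<close> and z vanishes, and a module with
  carries modulo 9 replaces the coordinates \<open>b\<close>, \<open>c\<close>, \<open>d\<close>,
  \<open>h\<close>. For p = 2 the commutator of \<open>b\<close> and \<open>c\<close>, which is 2 in
  \<open>h\<close>, vanishes, so a different group is needed.\<close>

lemma Ints_of_int_divide_iff:
  fixes m p :: int
  assumes "p \<noteq> 0"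
  shows "(of_int m / of_int p :: rat) \<in> \<int> \<longleftrightarrow> p dvd m"
proof
  assume "(of_int m / of_int p :: rat) \<in> \<int>"
  then obtain k where "(of_int m / of_int p :: rat) = of_int k" by (auto elim: Ints_cases)
  then have "(of_int m :: rat) = of_int (p * k)" using assms by (simp add: field_simps)
  then show "p dvd m" by (metis dvd_triv_left of_int_eq_iff)
next
  assume "p dvd m"
  then show "(of_int m / of_int p :: rat) \<in> \<int>" using assms by (auto elim!: dvdE)
qed

section \<open>Groups of reduced integer tuples\<close>

definition reduced_group :: "('a \<Rightarrow> 'a) \<Rightarrow> ('a \<Rightarrow> 'a \<Rightarrow> 'a) \<Rightarrow> 'a \<Rightarrow> 'a monoid" where
  "reduced_group r m e =
     \<lparr>carrier = range r, monoid.mult = \<lambda>x y. r (m x y), one = r e\<rparr>"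

lemma carrier_reduced_group [simp]: "carrier (reduced_group r m e) = range r"
  and mult_reduced_group [simp]: "x \<otimes>\<^bsub>reduced_group r m e\<^esub> y = r (m x y)"
  and one_reduced_group [simp]: "\<one>\<^bsub>reduced_group r m e\<^esub> = r e"
  by (simp_all add: reduced_group_def)

text \<open>By \<open>red\<close> and \<open>idem\<close> the fibres of \<open>r\<close> form a
  congruence for \<open>m\<close>, and the range of \<open>r\<close> is a set of representatives.
  The group laws can thus be checked as congruences between unreduced integers; \<open>m\<close>
  itself may be associative only up to \<open>r\<close>, as happens for p = 3 and p = 2.\<close>

lemma group_reduced_group:
  fixes m :: "'a \<Rightarrow> 'a \<Rightarrow> 'a" and r i :: "'a \<Rightarrow> 'a"
  assumes red: "\<And>x y. r (m (r x) (r y)) = r (m x y)"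
    and idem: "\<And>x. r (r x) = r x"
    and assoc: "\<And>x y z. r (m (m x y) z) = r (m x (m y z))"
    and one: "\<And>x. r (m e x) = r x"
    and inv: "\<And>x. r (m (i x) x) = r e"
  shows "group (reduced_group r m e)"
proof -
  have redl: "r (m (r x) y) = r (m x y)" and redr: "r (m x (r y)) = r (m x y)" for x y
    using red[of x y] red[of "r x" y] red[of x "r y"] by (simp_all add: idem)
  show ?thesis
  proof (rule groupI)
    fix x
    assume "x \<in> carrier (reduced_group r m e)"
    show "\<exists>y\<in>carrier (reduced_group r m e).
        y \<otimes>\<^bsub>reduced_group r m e\<^esub> x
          = \<one>\<^bsub>reduced_group r m e\<^esub>"
      by (rule bexI[of _ "r (i x)"]) (simp_all add: redl inv)
  qed (auto simp: redl redr assoc one idem)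
qed

section \<open>Criteria for a class to be nontrivial and to lie in B_0\<close>

text \<open>In the central extension defined by \<open>f\<close>, the two lifts of \<open>z\<close> coming from the commutators
  of lifts of \<open>x, y\<close> and of \<open>u, v\<close> differ by a nontrivial central element, which a splitting
  \<open>c\<close> would have to kill.\<close>

lemma not_coboundary2_onI:
  fixes f :: "'a \<Rightarrow> 'a \<Rightarrow> rat"
  assumes G: "group G" and S: "{x, y, z, u, v} \<subseteq> carrier G"
    and xy: "x \<otimes>\<^bsub>G\<^esub> y = (y \<otimes>\<^bsub>G\<^esub> x) \<otimes>\<^bsub>G\<^esub> z"
    and uv: "u \<otimes>\<^bsub>G\<^esub> v = (v \<otimes>\<^bsub>G\<^esub> u) \<otimes>\<^bsub>G\<^esub> z"
    and z: "\<And>g. g \<in> carrier G \<Longrightarrow> f g z \<in> \<int>"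
    and fuv: "f u v - f v u \<in> \<int>" and fxy: "f x y - f y x \<notin> \<int>"
  shows "\<not> coboundary2_on G (carrier G) f"
proof
  interpret group G by fact
  assume "coboundary2_on G (carrier G) f"
  then obtain c where c: "f g h - (c g + c h - c (g \<otimes>\<^bsub>G\<^esub> h)) \<in> \<int>"
    if "g \<in> carrier G" "h \<in> carrier G" for g h
    unfolding coboundary2_on_def by blast
  \<comment> \<open>A splitting forces \<open>f g h - f h g\<close> to be \<open>- c z\<close>
    modulo integers for every pair with commutator \<open>z\<close>, hence to be the same for both
    pairs.\<close>
  have comm: "f g h - f h g + c z \<in> \<int>"
    if "g \<in> carrier G" "h \<in> carrier G" "g \<otimes>\<^bsub>G\<^esub> h = (h \<otimes>\<^bsub>G\<^esub> g) \<otimes>\<^bsub>G\<^esub> z" for g h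
  proof -
    let ?k = "h \<otimes>\<^bsub>G\<^esub> g"
    have "(f g h - (c g + c h - c (g \<otimes>\<^bsub>G\<^esub> h))) - (f h g - (c h + c g - c ?k))
        - (f ?k z - (c ?k + c z - c (?k \<otimes>\<^bsub>G\<^esub> z))) + f ?k z \<in> \<int>"
      using S that by (intro Ints_add[OF Ints_diff[OF Ints_diff[OF c c] c] z]) auto
    then show ?thesis using that(3) by (simp add: algebra_simps)
  qed
  have "(f x y - f y x + c z) - (f u v - f v u + c z) + (f u v - f v u) \<in> \<int>"
    using S by (intro Ints_add[OF Ints_diff[OF comm[OF _ _ xy] comm[OF _ _ uv]] fuv]) auto
  then show False using fxy by simp
qed

text \<open>Bicyclic subgroups are commutative subsets, and the splittings below are built on any
  such subset from relations between pairs of its elements.\<close>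

lemma bogomolov_nontrivialI:
  assumes "cocycle2 G f" "\<not> coboundary2_on G (carrier G) f"
    and "\<And>A. A \<subseteq> carrier G \<Longrightarrow> (\<And>x y. x \<in> A \<Longrightarrow> y \<in> A \<Longrightarrow> x \<otimes>\<^bsub>G\<^esub> y = y \<otimes>\<^bsub>G\<^esub> x) \<Longrightarrow>
           coboundary2_on G A f"
  shows "bogomolov_nontrivial G"
  using assms unfolding bogomolov_nontrivial_def bicyclic_subgroup_def
  by (meson subgroup.subset)

section \<open>Cocycles inflated from Heisenberg groups modulo odd primes\<close>

text \<open>Since $(s + s')^3 - s^3 - s'^3 = 3 s s' (s + s')$, a multiple of $u^3$ works. For $p = 3$ the
  denominator $9$ is harmless because $u^3$ modulo $9$ only depends on $u$ modulo $3$.\<close>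

lemma cubic_primitive:
  fixes p N :: int
  assumes "Factorial_Ring.prime p"
  shows "\<exists>\<kappa> :: rat. \<forall>s s' u. [u = s + s'] (mod p) \<longrightarrow>
    \<kappa> * of_int (u ^ 3 - s ^ 3 - s' ^ 3) - of_int (N * s * s' * (s + s')) / of_int p \<in> \<int>"
proof (cases "p = 3")
  case True
  show ?thesis
  proof (intro exI allI impI)
    fix s s' u assume "[u = s + s'] (mod p)"
    then obtain k where k: "u = s + s' + 3 * k"
      using True by (metis cong_iff_lin cong_sym)
    have "of_int N / 9 * of_int (u ^ 3 - s ^ 3 - s' ^ 3) - of_int (N * s * s' * (s + s')) / of_int p
        = (of_int (N * ((s + s') ^ 2 * k + 3 * (s + s') * k ^ 2 + 3 * k ^ 3)) :: rat)"
      unfolding k True by (simp add: field_simps power2_eq_square power3_eq_cube)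
    then show "of_int N / 9 * of_int (u ^ 3 - s ^ 3 - s' ^ 3)
        - of_int (N * s * s' * (s + s')) / of_int p \<in> (\<int> :: rat set)" by simp
  qed
next
  case False
  have "Factorial_Ring.prime (3 :: int)" by simp
  then have "coprime 3 p" using False assms primes_coprime by metis
  \<comment> \<open>An inverse of 3 modulo \<open>p\<close> stands in for 1/3, so that the
    coefficient \<open>N * S / p\<close> only sees \<open>u\<close> modulo \<open>p\<close>. For
    \<open>p = 3\<close> the true quotient N/9 was used.\<close>
  then obtain S where S: "[3 * S = 1] (mod p)" using cong_solve_coprime_int by blast
  show ?thesis
  proof (intro exI allI impI)
    fix s s' u assume u: "[u = s + s'] (mod p)"
    have "[N * S * (u ^ 3 - s ^ 3 - s' ^ 3) = N * S * ((s + s') ^ 3 - s ^ 3 - s' ^ 3)] (mod p)"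
      by (intro cong_mult cong_diff cong_pow cong_refl u)
    also have "N * S * ((s + s') ^ 3 - s ^ 3 - s' ^ 3) = (3 * S) * (N * s * s' * (s + s'))"
      by (simp add: algebra_simps power3_eq_cube)
    also have "[\<dots> = 1 * (N * s * s' * (s + s'))] (mod p)"
      by (intro cong_mult cong_refl S)
    finally have "p dvd N * S * (u ^ 3 - s ^ 3 - s' ^ 3) - N * s * s' * (s + s')"
      by (simp add: cong_iff_dvd_diff)
    then have "(of_int (N * S * (u ^ 3 - s ^ 3 - s' ^ 3) - N * s * s' * (s + s')) / of_int p :: rat) \<in> \<int>"
      using assms by (intro iffD2[OF Ints_of_int_divide_iff]) auto
    then show "of_int (N * S) / of_int p * of_int (u ^ 3 - s ^ 3 - s' ^ 3)
        - of_int (N * s * s' * (s + s')) / of_int p \<in> (\<int> :: rat set)"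
      by (simp add: diff_divide_distrib)
  qed
qed

text \<open>The maps \<open>t\<close>, \<open>b\<close>, \<open>c\<close> are the coordinates of a homomorphism to the Heisenberg
  group modulo \<open>p\<close>, and \<open>F\<close> is a cocycle inflated from there. On a commutative subset
  either \<open>t\<close> vanishes, and then so does \<open>F\<close>, or \<open>b\<close> is linear and \<open>c\<close> quadratic in \<open>t\<close>, and
  then \<open>F\<close> is a multiple of $t t' (t + t')$.\<close>

lemma heisenberg_criterion:
  fixes p :: int and t b c :: "'a \<Rightarrow> int"
  defines "F \<equiv> \<lambda>x y. b x * (c y + t x * b y) - c x * b y"
  assumes G: "group G" and p: "Factorial_Ring.prime p" "odd p"
    and t: "\<And>x y. x \<in> carrier G \<Longrightarrow> y \<in> carrier G \<Longrightarrow> [t (x \<otimes>\<^bsub>G\<^esub> y) = t x + t y] (mod p)"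
    and b: "\<And>x y. x \<in> carrier G \<Longrightarrow> y \<in> carrier G \<Longrightarrow> [b (x \<otimes>\<^bsub>G\<^esub> y) = b x + b y] (mod p)"
    and c: "\<And>x y. x \<in> carrier G \<Longrightarrow> y \<in> carrier G \<Longrightarrow>
              [c (x \<otimes>\<^bsub>G\<^esub> y) = c x + c y + t x * b y] (mod p)"
    and comm1: "\<And>x y. x \<in> carrier G \<Longrightarrow> y \<in> carrier G \<Longrightarrow> x \<otimes>\<^bsub>G\<^esub> y = y \<otimes>\<^bsub>G\<^esub> x \<Longrightarrow>
              [t x * b y = t y * b x] (mod p)"
    and comm2: "\<And>x y. x \<in> carrier G \<Longrightarrow> y \<in> carrier G \<Longrightarrow> x \<otimes>\<^bsub>G\<^esub> y = y \<otimes>\<^bsub>G\<^esub> x \<Longrightarrow>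
              [2 * t x * c y + (t x)\<^sup>2 * b y = 2 * t y * c x + (t y)\<^sup>2 * b x] (mod p)"
    and comm3: "\<And>x y. x \<in> carrier G \<Longrightarrow> y \<in> carrier G \<Longrightarrow> x \<otimes>\<^bsub>G\<^esub> y = y \<otimes>\<^bsub>G\<^esub> x \<Longrightarrow>
              p dvd t x \<Longrightarrow> p dvd t y \<Longrightarrow> [b x * c y = c x * b y] (mod p)"
    and S: "{x, y, z, u, v} \<subseteq> carrier G"
    and xy: "x \<otimes>\<^bsub>G\<^esub> y = (y \<otimes>\<^bsub>G\<^esub> x) \<otimes>\<^bsub>G\<^esub> z"
    and uv: "u \<otimes>\<^bsub>G\<^esub> v = (v \<otimes>\<^bsub>G\<^esub> u) \<otimes>\<^bsub>G\<^esub> z"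
    and z: "p dvd b z" "p dvd c z" and v: "p dvd b v" "p dvd c v"
    and Fxy: "\<not> [F x y = F y x] (mod p)"
  shows "bogomolov_nontrivial G"
proof -
  interpret group G by fact
  define f where "f = (\<lambda>x y. of_int (F x y) / of_int p :: rat)"
  have p0: "p \<noteq> 0" using p by auto
  have f_Ints: "f x y \<in> \<int>" if "p dvd F x y" for x y
    unfolding f_def using that by (simp only: Ints_of_int_divide_iff[OF p0])
  have "cocycle2 G f"
    unfolding cocycle2_def
  proof (intro ballI)
    fix g h k assume [simp]: "g \<in> carrier G" "h \<in> carrier G" "k \<in> carrier G"
    have "[F g h + F (g \<otimes>\<^bsub>G\<^esub> h) k - F g (h \<otimes>\<^bsub>G\<^esub> k) - F h k
      = F g h + ((b g + b h) * (c k + (t g + t h) * b k) - (c g + c h + t g * b h) * b k)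
        - (b g * ((c h + c k + t h * b k) + t g * (b h + b k)) - c g * (b h + b k)) - F h k] (mod p)"
      unfolding F_def by (intro cong_add cong_diff cong_mult cong_refl t b c) simp_all
    also have "F g h + ((b g + b h) * (c k + (t g + t h) * b k) - (c g + c h + t g * b h) * b k)
        - (b g * ((c h + c k + t h * b k) + t g * (b h + b k)) - c g * (b h + b k)) - F h k = 0"
      by (simp add: F_def algebra_simps)
    finally have "(of_int (F g h + F (g \<otimes>\<^bsub>G\<^esub> h) k - F g (h \<otimes>\<^bsub>G\<^esub> k) - F h k) / of_int p :: rat) \<in> \<int>"
      by (intro iffD2[OF Ints_of_int_divide_iff] p0) (simp add: cong_0_iff)
    then show "f g h + f (g \<otimes>\<^bsub>G\<^esub> h) k - f g (h \<otimes>\<^bsub>G\<^esub> k) - f h k \<in> \<int>"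
      by (simp add: f_def diff_divide_distrib add_divide_distrib)
  qed
  moreover have "\<not> coboundary2_on G (carrier G) f"
  proof (rule not_coboundary2_onI[OF G S xy uv])
    show "f g z \<in> \<int>" for g
      using z by (intro f_Ints) (auto simp: F_def)
    show "f u v - f v u \<in> \<int>"
      using v by (intro Ints_diff f_Ints) (auto simp: F_def)
    have "\<not> p dvd F x y - F y x" using Fxy by (simp add: cong_iff_dvd_diff)
    then have "(of_int (F x y - F y x) / of_int p :: rat) \<notin> \<int>"
      by (simp only: Ints_of_int_divide_iff[OF p0] not_False_eq_True)
    then show "f x y - f y x \<notin> \<int>"
      by (simp add: f_def diff_divide_distrib)
  qed
  moreover have "coboundary2_on G A f"
    if A: "A \<subseteq> carrier G" and comm: "\<And>x y. x \<in> A \<Longrightarrow> y \<in> A \<Longrightarrow> x \<otimes>\<^bsub>G\<^esub> y = y \<otimes>\<^bsub>G\<^esub> x" for A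
  proof (cases "\<forall>x\<in>A. p dvd t x")
    case True
    have "f g h \<in> \<int>" if "g \<in> A" "h \<in> A" for g h
    proof (rule f_Ints)
      have "p dvd b g * c h - c g * b h"
        using comm3[of g h] comm[of g h] A True that by (auto simp: cong_iff_dvd_diff)
      moreover have "p dvd b g * t g * b h" using True that by auto
      moreover have "F g h = (b g * c h - c g * b h) + b g * t g * b h"
        by (simp add: F_def algebra_simps)
      ultimately show "p dvd F g h" by simp
    qed
    then show ?thesis unfolding coboundary2_on_def by (intro exI[of _ "\<lambda>_. 0"]) auto
  next
    case False
    then obtain w where w: "w \<in> A" "\<not> p dvd t w" by blast
    then have "coprime (t w) p" using p by (metis coprime_commute prime_imp_coprime)
    then obtain T where T: "[t w * T = 1] (mod p)" using cong_solve_coprime_int by blast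
    have "coprime 2 p" using p by simp
    then obtain K where K: "[2 * K = 1] (mod p)" using cong_solve_coprime_int by blast
    \<comment> \<open>With \<open>K\<close> for 1/2 and \<open>T\<close> for the inverse of
      \<open>t w\<close>, the curve with \<open>b = l * t\<close> and
      \<open>c = r * t + K * l * t^2\<close> is the one-parameter subgroup of the Heisenberg group
      through \<open>w\<close>; \<open>r\<close> is fitted to the value \<open>c w\<close>. The
      commutation relations with \<open>w\<close> place all of \<open>A\<close> on this
      curve.\<close>
    define l where "l = b w * T"
    define r where "r = c w * T - K * t w * l"
    have c1: "[t w * b g = t g * b w] (mod p)"
      and c2: "[2 * t w * c g + (t w)\<^sup>2 * b g = 2 * t g * c w + (t g)\<^sup>2 * b w] (mod p)"
      if "g \<in> A" for g
      using comm1[of w g] comm2[of w g] comm[of w g] A w that by auto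
    have bg: "[b g = l * t g] (mod p)" if "g \<in> A" for g
    proof -
      have "[b g * 1 = b g * (t w * T)] (mod p)" using T by (intro cong_mult cong_refl) (rule cong_sym)
      also have "b g * (t w * T) = (t w * b g) * T" by simp
      also have "[\<dots> = (t g * b w) * T] (mod p)"
        by (intro cong_mult[OF c1[OF that]] cong_refl)
      finally show ?thesis by (simp add: l_def mult_ac)
    qed
    have cg: "[c g = r * t g + K * l * (t g)\<^sup>2] (mod p)" if "g \<in> A" for g
    proof -
      have "[1 * 1 * c g = (2 * K) * (t w * T) * c g] (mod p)"
        using T K by (intro cong_mult cong_refl) (auto intro: cong_sym)
      also have "(2 * K) * (t w * T) * c g
          = K * T * (2 * t w * c g + (t w)\<^sup>2 * b g) - K * (t w * T) * t w * b g"
        by (simp add: algebra_simps power2_eq_square)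
      also have "[\<dots> = K * T * (2 * t g * c w + (t g)\<^sup>2 * b w) - K * 1 * t w * (l * t g)] (mod p)"
        by (rule cong_diff[OF cong_mult[OF cong_refl c2[OF that]]
              cong_mult[OF cong_mult[OF cong_mult[OF cong_refl T] cong_refl] bg[OF that]]])
      also have "K * T * (2 * t g * c w + (t g)\<^sup>2 * b w) - K * 1 * t w * (l * t g)
          = (2 * K) * (c w * T * t g) + K * l * (t g)\<^sup>2 - K * t w * l * t g"
        by (simp add: l_def algebra_simps)
      also have "[\<dots> = 1 * (c w * T * t g) + K * l * (t g)\<^sup>2 - K * t w * l * t g] (mod p)"
        by (intro cong_mult cong_refl cong_diff cong_add K)
      finally show ?thesis by (simp add: r_def algebra_simps)
    qed
    define N where "N = K * l\<^sup>2"
    have FN: "[F g h = N * t g * t h * (t g + t h)] (mod p)" if "g \<in> A" "h \<in> A" for g h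
    proof -
      have "[F g h = (l * t g) * ((r * t h + K * l * (t h)\<^sup>2) + t g * (l * t h))
          - (r * t g + K * l * (t g)\<^sup>2) * (l * t h)] (mod p)"
        unfolding F_def by (intro cong_add cong_diff cong_mult cong_refl bg cg that)
      also have "(l * t g) * ((r * t h + K * l * (t h)\<^sup>2) + t g * (l * t h))
          - (r * t g + K * l * (t g)\<^sup>2) * (l * t h)
          = 1 * (l\<^sup>2 * (t g)\<^sup>2 * t h) + N * t g * (t h)\<^sup>2 - N * (t g)\<^sup>2 * t h"
        by (simp add: N_def algebra_simps power2_eq_square)
      also have "[\<dots> = (2 * K) * (l\<^sup>2 * (t g)\<^sup>2 * t h) + N * t g * (t h)\<^sup>2 - N * (t g)\<^sup>2 * t h] (mod p)"
        using K by (intro cong_mult cong_refl cong_diff cong_add) (rule cong_sym)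
      also have "(2 * K) * (l\<^sup>2 * (t g)\<^sup>2 * t h) + N * t g * (t h)\<^sup>2 - N * (t g)\<^sup>2 * t h
          = N * t g * t h * (t g + t h)"
        by (simp add: N_def algebra_simps power2_eq_square)
      finally show ?thesis .
    qed
    obtain \<kappa> :: rat where \<kappa>: "\<And>s s' u. [u = s + s'] (mod p) \<Longrightarrow>
        \<kappa> * of_int (u ^ 3 - s ^ 3 - s' ^ 3) - of_int (N * s * s' * (s + s')) / of_int p \<in> \<int>"
      using cubic_primitive[OF p(1), of N] by blast
    show ?thesis
      unfolding coboundary2_on_def
    proof (intro exI ballI)
      fix g h assume gh: "g \<in> A" "h \<in> A"
      have "p dvd F g h - N * t g * t h * (t g + t h)"
        using FN[OF gh] by (simp add: cong_iff_dvd_diff)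
      then have "(of_int (F g h - N * t g * t h * (t g + t h)) / of_int p :: rat) \<in> \<int>"
        by (simp only: Ints_of_int_divide_iff[OF p0])
      then have "f g h - of_int (N * t g * t h * (t g + t h)) / of_int p \<in> \<int>"
        by (simp add: f_def diff_divide_distrib)
      from Ints_diff[OF this \<kappa>[of "t (g \<otimes>\<^bsub>G\<^esub> h)" "t g" "t h"]]
      show "f g h - (- \<kappa> * of_int (t g ^ 3) + - \<kappa> * of_int (t h ^ 3)
          - (- \<kappa> * of_int (t (g \<otimes>\<^bsub>G\<^esub> h) ^ 3))) \<in> \<int>"
        using t gh A by (auto simp: algebra_simps)
    qed
  qed
  ultimately show ?thesis by (rule bogomolov_nontrivialI)
qed

section \<open>Inflation along a retraction, and direct factors\<close>

lemma bogomolov_nontrivial_retract: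
  assumes G: "group G" and H: "group H" and \<pi>: "\<pi> \<in> hom G H" and s: "s \<in> hom H G"
    and retract: "\<And>x. x \<in> carrier H \<Longrightarrow> \<pi> (s x) = x"
    and nontriv: "bogomolov_nontrivial H"
  shows "bogomolov_nontrivial G"
proof -
  interpret \<pi>: group_hom G H \<pi> using G H \<pi> by (simp add: group_hom_def group_hom_axioms_def)
  obtain f where f: "cocycle2 H f" "\<not> coboundary2_on H (carrier H) f"
    "\<And>A. bicyclic_subgroup H A \<Longrightarrow> coboundary2_on H A f"
    using nontriv unfolding bogomolov_nontrivial_def by blast
  define f' where "f' = (\<lambda>g h. f (\<pi> g) (\<pi> h))"
  have "cocycle2 G f'"
    using f(1) by (simp add: cocycle2_def f'_def)
  moreover have "\<not> coboundary2_on G (carrier G) f'"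
  proof
    assume "coboundary2_on G (carrier G) f'"
    then obtain c where c: "f (\<pi> g) (\<pi> h) - (c g + c h - c (g \<otimes>\<^bsub>G\<^esub> h)) \<in> \<int>"
      if "g \<in> carrier G" "h \<in> carrier G" for g h
      unfolding coboundary2_on_def f'_def by blast
    \<comment> \<open>Inflation is injective here: restricting a splitting along the section
      \<open>s\<close> recovers a splitting of \<open>f\<close>.\<close>
    have "f x y - (c (s x) + c (s y) - c (s (x \<otimes>\<^bsub>H\<^esub> y))) \<in> \<int>"
      if "x \<in> carrier H" "y \<in> carrier H" for x y
      using c[of "s x" "s y"] that s by (simp add: retract hom_mult hom_in_carrier)
    then have "coboundary2_on H (carrier H) f"
      unfolding coboundary2_on_def by (intro exI[of _ "\<lambda>x. c (s x)"] ballI)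
    then show False using f(2) by contradiction
  qed
  \<comment> \<open>The image of a bicyclic subgroup is bicyclic, generated by the images of the two
    generators, so a splitting of \<open>f\<close> on the image pulls back.\<close>
  moreover have "coboundary2_on G A f'" if A: "bicyclic_subgroup G A" for A
  proof -
    from A have "A \<subseteq> carrier G" by (auto simp: bicyclic_subgroup_def dest: subgroup.subset)
    obtain a b where "a \<in> carrier G" "b \<in> carrier G" "A = generate G {a, b}"
      using A by (auto simp: bicyclic_subgroup_def)
    then have "\<pi> ` A = generate H {\<pi> a, \<pi> b}" "\<pi> a \<in> carrier H" "\<pi> b \<in> carrier H"
      using \<pi>.generate_img[of "{a, b}"] by auto
    moreover have "\<forall>x\<in>\<pi> ` A. \<forall>y\<in>\<pi> ` A. x \<otimes>\<^bsub>H\<^esub> y = y \<otimes>\<^bsub>H\<^esub> x"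
    proof (intro ballI, elim imageE)
      fix x y g h assume "x = \<pi> g" "g \<in> A" "y = \<pi> h" "h \<in> A"
      moreover from this have "g \<otimes>\<^bsub>G\<^esub> h = h \<otimes>\<^bsub>G\<^esub> g" using A by (auto simp: bicyclic_subgroup_def)
      ultimately show "x \<otimes>\<^bsub>H\<^esub> y = y \<otimes>\<^bsub>H\<^esub> x"
        using \<open>A \<subseteq> carrier G\<close> by (metis \<pi>.hom_mult subsetD)
    qed
    moreover have "subgroup (\<pi> ` A) H"
      using A by (intro \<pi>.subgroup_img_is_subgroup) (simp add: bicyclic_subgroup_def)
    ultimately have "coboundary2_on H (\<pi> ` A) f"
      by (intro f(3)) (auto simp: bicyclic_subgroup_def)
    then obtain c where c: "f x y - (c x + c y - c (x \<otimes>\<^bsub>H\<^esub> y)) \<in> \<int>"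
      if "x \<in> \<pi> ` A" "y \<in> \<pi> ` A" for x y
      unfolding coboundary2_on_def by blast
    have "f' g h - (c (\<pi> g) + c (\<pi> h) - c (\<pi> (g \<otimes>\<^bsub>G\<^esub> h))) \<in> \<int>" if "g \<in> A" "h \<in> A" for g h
      using c[of "\<pi> g" "\<pi> h"] that \<open>A \<subseteq> carrier G\<close> by (simp add: f'_def subset_iff)
    then show ?thesis unfolding coboundary2_on_def by (intro exI[of _ "\<lambda>g. c (\<pi> g)"] ballI)
  qed
  ultimately show ?thesis unfolding bogomolov_nontrivial_def by blast
qed

text \<open>The projection of H x C_k to H is a retraction; an injective numbering of the finite
  product moves it to the natural numbers.\<close>

lemma bogomolov_nontrivial_nat_multiple:
  assumes H: "group H" "finite (carrier H)" "order H = m" and nontriv: "bogomolov_nontrivial H"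
    and "k > 0"
  shows "\<exists>G :: nat monoid. group G \<and> finite (carrier G) \<and> order G = m * k \<and>
           bogomolov_nontrivial G"
proof -
  define K where "K = H \<times>\<times> integer_mod_group k"
  have K: "group K" unfolding K_def by (intro DirProd_group H) simp
  have carrier_K: "carrier K = carrier H \<times> {0..<int k}"
    using \<open>k > 0\<close> by (simp add: K_def carrier_integer_mod_group)
  have fin: "finite (carrier K)" using H by (simp add: carrier_K)
  then obtain \<phi> :: "_ \<Rightarrow> nat" where \<phi>: "inj_on \<phi> (carrier K)"
    using finite_imp_inj_to_nat_seg by blast
  define G where "G = image_group \<phi> K"
  have G: "group G" unfolding G_def using group.inj_imp_image_group_is_group[OF K \<phi>] .
  have iso: "\<phi> \<in> Group.iso K G" unfolding G_def using inj_imp_image_group_iso[OF \<phi>] .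
  have carrier_G: "carrier G = \<phi> ` carrier K" by (simp add: G_def image_group_carrier)
  have "order G = card (carrier K)" using \<phi> by (simp add: order_def carrier_G card_image)
  also have "\<dots> = m * k" using H(3) by (simp add: carrier_K card_cartesian_product order_def)
  finally have "order G = m * k" .
  moreover have "bogomolov_nontrivial G"
  proof (rule bogomolov_nontrivial_retract[OF G H(1) _ _ _ nontriv])
    have "inv_into (carrier K) \<phi> \<in> hom G K"
      using group.iso_set_sym[OF K iso] by (simp add: Group.iso_def)
    moreover have "fst \<in> hom K H" by (auto simp: hom_def K_def)
    ultimately show "fst \<circ> inv_into (carrier K) \<phi> \<in> hom G H" by (rule hom_compose)
    have "(\<lambda>x. (x, 0)) \<in> hom H K" using \<open>k > 0\<close> by (auto simp: hom_def K_def)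
    moreover have "\<phi> \<in> hom K G" using iso by (simp add: Group.iso_def)
    ultimately show "\<phi> \<circ> (\<lambda>x. (x, 0)) \<in> hom H G" by (rule hom_compose)
    show "(fst \<circ> inv_into (carrier K) \<phi>) ((\<phi> \<circ> (\<lambda>x. (x, 0))) x) = x" if "x \<in> carrier H" for x
      using \<phi> that \<open>k > 0\<close> by (simp add: carrier_K)
  qed
  ultimately show ?thesis using G fin by (auto simp: carrier_G)
qed

subsection \<open>The groups of order $p^5$ for $p \ge 5$\<close>

text \<open>The coordinate $t$ acts on $(b, c, d)$ and on the untwisted part of $h$ as the shift
  $X \mapsto X + t$ acts on binary cubic forms. The Lie-symmetric term
  $b (c' + t b') - c b'$ added to $h$ makes the same central coordinate also
  a commutator of the directions $b$ and $c$.\<close>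

definition shift_mult where
  "shift_mult = (\<lambda>(t, b, c, d, h) (t', b', c', d', h'). (t + t', b + b', c + c' + t * b',
     d + d' + 2 * t * c' + t\<^sup>2 * b',
     h + h' + 3 * t * d' + 3 * t\<^sup>2 * c' + t ^ 3 * b' + b * (c' + t * b') - c * b' :: int))"

definition shift_red :: "int \<Rightarrow> int \<times> int \<times> int \<times> int \<times> int \<Rightarrow> int \<times> int \<times> int \<times> int \<times> int" where
  "shift_red p = (\<lambda>(t, b, c, d, h). (t mod p, b mod p, c mod p, d mod p, h mod p))"

lemma shift_mult_cong:
  "shift_red p (shift_mult (shift_red p x) (shift_red p y)) = shift_red p (shift_mult x y)"
  by (cases x; cases y)
    (auto simp: shift_red_def shift_mult_def simp flip: cong_def
      intro!: cong_add cong_diff cong_mult cong_pow)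

lemma group_shift: "group (reduced_group (shift_red p) shift_mult (0, 0, 0, 0, 0))"
\<comment> \<open>The inverse negates the vector shifted by \<open>- t\<close>. The twist of
  \<open>h\<close> drops out because it pairs a vector with its own negative.\<close>
proof (rule group_reduced_group[where
      i = "\<lambda>(t, b, c, d, h). (- t, - b, - (c - t * b), - (d - 2 * t * c + t\<^sup>2 * b),
        - (h - 3 * t * d + 3 * t\<^sup>2 * c - t ^ 3 * b))"])
  show "shift_red p (shift_mult (shift_mult x y) z) = shift_red p (shift_mult x (shift_mult y z))"
    for x y z
    by (cases x; cases y; cases z)
      (simp add: shift_mult_def algebra_simps power2_eq_square power3_eq_cube)
qed (auto simp: shift_mult_cong,
    auto simp: shift_red_def shift_mult_def algebra_simps power2_eq_square power3_eq_cube)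

lemma order_shift:
  fixes p :: nat
  assumes "p > 0"
  defines "G \<equiv> reduced_group (shift_red (int p)) shift_mult (0, 0, 0, 0, 0)"
  shows "finite (carrier G)" "order G = p ^ 5"
proof -
  have "range (shift_red p) = {0..<int p} \<times> {0..<int p} \<times> {0..<int p} \<times> {0..<int p} \<times> {0..<int p}"
    (is "_ = ?C")
  proof (intro equalityI subsetI)
    show "x \<in> ?C" if "x \<in> range (shift_red p)" for x using that assms by (auto simp: shift_red_def)
    show "x \<in> range (shift_red p)" if "x \<in> ?C" for x
      using that by (intro range_eqI[of _ _ x]) (auto simp: shift_red_def)
  qed
  then show "finite (carrier G)" "order G = p ^ 5"
    by (simp_all add: G_def order_def card_cartesian_product eval_nat_numeral)
qed

text \<open>The three commutation conditions of the criterion are read off, in order, from the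
  coordinates \<open>c\<close>, \<open>d\<close> and \<open>h\<close> of the two products.\<close>

lemma bogomolov_nontrivial_shift:
  fixes p :: int
  assumes p: "Factorial_Ring.prime p" "p > 3"
  shows "bogomolov_nontrivial (reduced_group (shift_red p) shift_mult (0, 0, 0, 0, 0))"
proof -
  have odd: "odd p" using p prime_odd_int by force
  have "Factorial_Ring.prime (3 :: int)" by simp
  then have "coprime 3 p" using p by (metis less_irrefl primes_coprime)
  then obtain k0 where k0: "[3 * k0 = 1] (mod p)" using cong_solve_coprime_int by blast
  \<comment> \<open>\<open>k\<close> is 2/3 modulo \<open>p\<close>: the commutator of the
    directions \<open>t\<close> and \<open>d\<close> is \<open>3 * k\<close> in \<open>h\<close>,
    and must match the value 2 for the directions \<open>b\<close> and \<open>c\<close>.\<close>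
  define k where "k = 2 * k0"
  have k: "[3 * k = 2] (mod p)"
    using cong_mult[OF cong_refl[of 2] k0] by (simp add: k_def)
  have half: "p dvd m" if "p dvd 2 * m" for m
    using that odd coprime_dvd_mult_right_iff[of p 2 m] by simp
  show ?thesis
  proof (rule heisenberg_criterion[where p = p and t = fst and b = "fst \<circ> snd"
        and c = "fst \<circ> snd \<circ> snd"
        and x = "shift_red p (0, 1, 0, 0, 0)" and y = "shift_red p (0, 0, 1, 0, 0)"
        and z = "shift_red p (0, 0, 0, 0, 2)"
        and u = "shift_red p (1, 0, 0, 0, 0)" and v = "shift_red p (0, 0, 0, k, 0)"], goal_cases)
    case 1
    show ?case by (rule group_shift)
  next
    case (7 x y)
    then show ?case
      by (cases x; cases y)
        (simp add: shift_red_def shift_mult_def mod_eq_dvd_iff cong_iff_dvd_diff algebra_simps)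
  next
    case (8 x y)
    then show ?case
      by (cases x; cases y)
        (simp add: shift_red_def shift_mult_def mod_eq_dvd_iff cong_iff_dvd_diff algebra_simps)
  next
    case (9 x y)
    obtain t b c d h where x: "x = (t, b, c, d, h)" by (cases x)
    obtain t' b' c' d' h' where y: "y = (t', b', c', d', h')" by (cases y)
    have t: "[t = 0] (mod p)" "[t' = 0] (mod p)" using 9 x y by (simp_all add: cong_0_iff)
    have e0: "[h + h' + 3 * t * d' + 3 * t\<^sup>2 * c' + t ^ 3 * b' + b * (c' + t * b') - c * b'
       = h' + h + 3 * t' * d + 3 * t'\<^sup>2 * c + t' ^ 3 * b + b' * (c + t' * b) - c' * b] (mod p)"
      using 9 x y by (simp add: shift_red_def shift_mult_def cong_def)
    have e1: "[h + h' + 3 * t * d' + 3 * t\<^sup>2 * c' + t ^ 3 * b' + b * (c' + t * b') - c * b'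
       = h + h' + 3 * 0 * d' + 3 * 0\<^sup>2 * c' + 0 ^ 3 * b' + b * (c' + 0 * b') - c * b'] (mod p)"
      by (intro cong_add cong_diff cong_mult cong_pow cong_refl t)
    have e2: "[h' + h + 3 * t' * d + 3 * t'\<^sup>2 * c + t' ^ 3 * b + b' * (c + t' * b) - c' * b
       = h' + h + 3 * 0 * d + 3 * 0\<^sup>2 * c + 0 ^ 3 * b + b' * (c + 0 * b) - c' * b] (mod p)"
      by (intro cong_add cong_diff cong_mult cong_pow cong_refl t)
    have "[h + h' + 3 * 0 * d' + 3 * 0\<^sup>2 * c' + 0 ^ 3 * b' + b * (c' + 0 * b') - c * b'
       = h' + h + 3 * 0 * d + 3 * 0\<^sup>2 * c + 0 ^ 3 * b + b' * (c + 0 * b) - c' * b] (mod p)"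
      by (rule cong_trans[OF cong_trans[OF cong_sym[OF e1] e0] e2])
    then have "p dvd 2 * (b * c' - c * b')" by (simp add: cong_iff_dvd_diff algebra_simps)
    then have "p dvd b * c' - c * b'" by (rule half)
    then show ?case using x y by (simp add: cong_iff_dvd_diff)
  next
    case 10
    show ?case by simp
  next
    case 12
    have "(3 * k) mod p = 2 mod p" using k by (simp add: cong_def)
    moreover have "1 mod p = 1" using p by simp
    ultimately show ?case by (simp add: shift_red_def shift_mult_def mod_simps)
  next
    case 17
    have "\<not> p dvd 2" using p zdvd_imp_le[of p 2] by auto
    then show ?case using p by (simp add: shift_red_def cong_iff_dvd_diff)
  qed (use p odd in \<open>auto simp: shift_red_def shift_mult_def cong_def mod_simps range_eqI\<close>)
qed

subsection \<open>The group of order $3^5$\<close>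

text \<open>For $p = 3$ the shift above degenerates, and the module is replaced by
  $V = \mathbb{Z}[\omega] / 9$ with $\omega$ a primitive cube root of unity. A pair $(x, y)$
  stands for $x + y\pi$ with $\pi = \omega - 1$, so that $\pi^2 = -3 - 3\pi$ and $\pi^4$ is $9$
  times a unit; \<open>(rotx t x y, roty t x y)\<close> is its multiple by $\omega^t$. The addition of $V$
  is twisted so that the commutator of $1$ and $\pi$ generates the subgroup of
  $\pi^3 = -3\pi$, which is fixed by $\omega$.\<close>

definition rotx :: "int \<Rightarrow> int \<Rightarrow> int \<Rightarrow> int" where
  "rotx t x y = (if t mod 3 = 0 then x else if t mod 3 = 1 then x - 3 * y else 3 * y - 2 * x)"

definition roty :: "int \<Rightarrow> int \<Rightarrow> int \<Rightarrow> int" where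
  "roty t x y = (if t mod 3 = 0 then y else if t mod 3 = 1 then x - 2 * y else y - x)"

definition eisenstein_mult :: "int \<times> int \<times> int \<Rightarrow> int \<times> int \<times> int \<Rightarrow> int \<times> int \<times> int" where
  "eisenstein_mult = (\<lambda>(t, x, y) (t', x', y'). (t + t', x + rotx t x' y',
     y + roty t x' y' - 3 * (x * roty t x' y' - y * rotx t x' y')))"

definition eisenstein_red :: "int \<times> int \<times> int \<Rightarrow> int \<times> int \<times> int" where
  "eisenstein_red = (\<lambda>(t, x, y). (t mod 3, x mod 9, y mod 9))"

lemma mod3_cases:
  fixes t :: int
  obtains "t mod 3 = 0" | "t mod 3 = 1" | "t mod 3 = 2"
proof -
  have "t mod 3 = 0 \<or> t mod 3 = 1 \<or> t mod 3 = 2" by presburger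
  then show thesis by (elim disjE) (fact that)+
qed

lemma rot_add:
  "rotx (s + t) x y = rotx s (rotx t x y) (roty t x y)"
  "roty (s + t) x y = roty s (rotx t x y) (roty t x y)"
proof -
  have "(s + t) mod 3 = (s mod 3 + t mod 3) mod 3" by (simp add: mod_simps)
  then show "rotx (s + t) x y = rotx s (rotx t x y) (roty t x y)"
    "roty (s + t) x y = roty s (rotx t x y) (roty t x y)"
    by (cases s rule: mod3_cases; cases t rule: mod3_cases; simp add: rotx_def roty_def)+
qed

lemma rot_mod [simp]: "rotx (t mod 3) x y = rotx t x y" "roty (t mod 3) x y = roty t x y"
  by (simp_all add: rotx_def roty_def)

lemma rot_cong:
  assumes "[x = x'] (mod m)" "[y = y'] (mod m)"
  shows "[rotx t x y = rotx t x' y'] (mod m)" "[roty t x y = roty t x' y'] (mod m)"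
  using assms by (auto simp: rotx_def roty_def intro!: cong_diff cong_mult)

lemma rot_sum:
  "rotx t (x + x') (y + y') = rotx t x y + rotx t x' y'"
  "roty t (x + x') (y + y') = roty t x y + roty t x' y'"
  by (simp_all add: rotx_def roty_def)

text \<open>Multiplication by a power of omega has determinant 1, its norm; hence the twist is
  invariant under rotation.\<close>

lemma rot_det: "rotx t x y * roty t x' y' - roty t x y * rotx t x' y' = x * y' - y * x'"
  by (simp add: rotx_def roty_def algebra_simps)

text \<open>omega^t - 1 is a multiple of pi, and 3 pi^2 = -9 - 9 pi vanishes modulo 9.\<close>

lemma rot_fixed: "[rotx t 0 (3 * m) = 0] (mod 9)" "[roty t 0 (3 * m) = 3 * m] (mod 9)"
  by (auto simp: rotx_def roty_def cong_iff_dvd_diff)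

lemma eisenstein_mult_cong:
  "eisenstein_red (eisenstein_mult (eisenstein_red v) (eisenstein_red w))
    = eisenstein_red (eisenstein_mult v w)"
  by (cases v; cases w)
    (auto simp: eisenstein_red_def eisenstein_mult_def mod_simps simp flip: cong_def
      intro!: cong_add cong_diff cong_mult rot_cong)

text \<open>The twist is bilinear modulo 9, rotation-invariant by \<open>rot_det\<close>, and has
  values in the multiples of 3 pi, which rotations fix by \<open>rot_fixed\<close>. A twist nested
  inside a twist carries a factor 9.\<close>

lemma eisenstein_mult_assoc:
  "eisenstein_red (eisenstein_mult (eisenstein_mult u v) w)
    = eisenstein_red (eisenstein_mult u (eisenstein_mult v w))"
proof -
  obtain t x y where u: "u = (t, x, y)" by (cases u)
  obtain t' x' y' where v: "v = (t', x', y')" by (cases v)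
  obtain t'' x'' y'' where w: "w = (t'', x'', y'')" by (cases w)
  define xa where xa: "xa = rotx t x' y'"
  define ya where ya: "ya = roty t x' y'"
  define xb where xb: "xb = rotx t' x'' y''"
  define yb where yb: "yb = roty t' x'' y''"
  define xc where xc: "xc = rotx t xb yb"
  define yc where yc: "yc = roty t xb yb"
  \<comment> \<open>\<open>3 * m\<close> is the twist arising in the product of \<open>v\<close> and
    \<open>w\<close>; by invariance it is also the twist after rotation by \<open>t\<close>.\<close>
  define m where "m = y' * xb - x' * yb"
  have m: "m = ya * xc - xa * yc"
    using rot_det[of t x' y' xb yb] by (simp add: xa ya xc yc m_def)
  have rx: "[rotx t (x' + xb) (y' + yb - 3 * (x' * yb - y' * xb)) = xa + xc] (mod 9)"
  proof -
    have "rotx t (x' + xb + 0) (y' + yb + 3 * m) = xa + xc + rotx t 0 (3 * m)"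
      by (simp only: rot_sum xa ya xc yc)
    moreover have "[xa + xc + rotx t 0 (3 * m) = xa + xc + 0] (mod 9)"
      by (intro cong_add cong_refl rot_fixed)
    ultimately show ?thesis by (simp add: m_def algebra_simps)
  qed
  have ry: "[roty t (x' + xb) (y' + yb - 3 * (x' * yb - y' * xb)) = ya + yc + 3 * m] (mod 9)"
  proof -
    have "roty t (x' + xb + 0) (y' + yb + 3 * m) = ya + yc + roty t 0 (3 * m)"
      by (simp only: rot_sum xa ya xc yc)
    moreover have "[ya + yc + roty t 0 (3 * m) = ya + yc + 3 * m] (mod 9)"
      by (intro cong_add cong_refl rot_fixed)
    ultimately show ?thesis by (simp add: m_def algebra_simps)
  qed
  have "[y + roty t (x' + xb) (y' + yb - 3 * (x' * yb - y' * xb))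
      - 3 * (x * roty t (x' + xb) (y' + yb - 3 * (x' * yb - y' * xb))
        - y * rotx t (x' + xb) (y' + yb - 3 * (x' * yb - y' * xb)))
    = y + (ya + yc + 3 * m) - 3 * (x * (ya + yc + 3 * m) - y * (xa + xc))] (mod 9)"
    by (intro cong_add cong_diff cong_mult cong_refl rx ry)
  moreover have "[y + (ya + yc + 3 * m) - 3 * (x * (ya + yc + 3 * m) - y * (xa + xc))
    = y + ya - 3 * (x * ya - y * xa) + yc
      - 3 * ((x + xa) * yc - (y + ya - 3 * (x * ya - y * xa)) * xc)] (mod 9)"
  proof -
    have "y + (ya + yc + 3 * m) - 3 * (x * (ya + yc + 3 * m) - y * (xa + xc))
      = y + ya - 3 * (x * ya - y * xa) + yc
        - 3 * ((x + xa) * yc - (y + ya - 3 * (x * ya - y * xa)) * xc)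
        + 9 * ((x * ya - y * xa) * xc - x * m)"
      by (simp add: m algebra_simps)
    then show ?thesis by (simp only: cong_iff_dvd_diff add_diff_cancel_left' dvd_triv_left)
  qed
  ultimately have y_eq: "[y + roty t (x' + xb) (y' + yb - 3 * (x' * yb - y' * xb))
      - 3 * (x * roty t (x' + xb) (y' + yb - 3 * (x' * yb - y' * xb))
        - y * rotx t (x' + xb) (y' + yb - 3 * (x' * yb - y' * xb)))
    = y + ya - 3 * (x * ya - y * xa) + yc
      - 3 * ((x + xa) * yc - (y + ya - 3 * (x * ya - y * xa)) * xc)] (mod 9)"
    by (rule cong_trans)
  have x_eq: "[x + rotx t (x' + xb) (y' + yb - 3 * (x' * yb - y' * xb)) = x + xa + xc] (mod 9)"
    using cong_add[OF cong_refl rx, of x] by (simp add: add_ac)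
  have "eisenstein_mult (eisenstein_mult u v) w = (t + t' + t'', x + xa + xc,
      y + ya - 3 * (x * ya - y * xa) + yc - 3 * ((x + xa) * yc - (y + ya - 3 * (x * ya - y * xa)) * xc))"
    by (simp add: u v w eisenstein_mult_def rot_add xa ya xb yb xc yc)
  moreover have "eisenstein_mult u (eisenstein_mult v w) = (t + (t' + t''),
      x + rotx t (x' + xb) (y' + yb - 3 * (x' * yb - y' * xb)),
      y + roty t (x' + xb) (y' + yb - 3 * (x' * yb - y' * xb))
      - 3 * (x * roty t (x' + xb) (y' + yb - 3 * (x' * yb - y' * xb))
        - y * rotx t (x' + xb) (y' + yb - 3 * (x' * yb - y' * xb))))"
    by (simp add: u v w eisenstein_mult_def xb yb)
  ultimately show ?thesis
    using cong_sym[OF x_eq] cong_sym[OF y_eq] by (simp add: eisenstein_red_def cong_def add.assoc)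
qed

lemma group_eisenstein: "group (reduced_group eisenstein_red eisenstein_mult (0, 0, 0))"
proof (rule group_reduced_group[where
      i = "\<lambda>(t, x, y). (- t, - rotx (- t) x y, - roty (- t) x y)"])
  show "eisenstein_red (eisenstein_mult (eisenstein_mult x y) z)
      = eisenstein_red (eisenstein_mult x (eisenstein_mult y z))" for x y z
    by (rule eisenstein_mult_assoc)
qed (auto simp: eisenstein_mult_cong,
    auto simp: eisenstein_red_def eisenstein_mult_def rotx_def roty_def algebra_simps)

lemma order_eisenstein:
  defines "G \<equiv> reduced_group eisenstein_red eisenstein_mult (0, 0, 0)"
  shows "finite (carrier G)" "order G = 243"
proof -
  have "range eisenstein_red = {0..<3} \<times> {0..<9} \<times> {0..<9}" (is "_ = ?C")
  proof (intro equalityI subsetI)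
    show "x \<in> ?C" if "x \<in> range eisenstein_red" for x using that by (auto simp: eisenstein_red_def)
    show "x \<in> range eisenstein_red" if "x \<in> ?C" for x
      using that by (intro range_eqI[of _ _ x]) (auto simp: eisenstein_red_def)
  qed
  then show "finite (carrier G)" "order G = 243"
    by (simp_all add: G_def order_def card_cartesian_product)
qed

text \<open>Expand (1 + pi)^t (x + y pi) in powers of pi. The coefficient of pi^2 is t y + t (t - 1)
  x / 2, and pi^2 = -3 - 3 pi, so \<open>p\<close> is this coefficient modulo 3; it is doubled to
  avoid the division. The term \<open>3 * q\<close> absorbs the remaining contributions to the
  coordinate of pi.\<close>

lemma rot_expansion:
  obtains p q where "rotx t x y = x - 3 * p" "roty t x y = y + t * x - 3 * q"
    "[2 * t * y + t\<^sup>2 * x = 2 * p + t * x] (mod 3)"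
proof (cases t rule: mod3_cases)
  case 1
  then obtain s where t: "t = 3 * s" by (metis mod_0_imp_dvd dvdE)
  have "2 * t * y + t\<^sup>2 * x - (2 * 0 + t * x) = 3 * (2 * s * y + 3 * s\<^sup>2 * x - s * x)"
    by (simp add: t power2_eq_square algebra_simps)
  then show thesis
    using 1 by (intro that[of 0 "s * x"])
      (simp_all only: cong_iff_dvd_diff dvd_triv_left, simp_all add: t rotx_def roty_def)
next
  case 2
  define s where "s = t div 3"
  have t: "t = 3 * s + 1" using 2 by (simp add: s_def) presburger
  have "2 * t * y + t\<^sup>2 * x - (2 * y + t * x) = 3 * (2 * s * y + 3 * s\<^sup>2 * x + s * x)"
    by (simp add: t power2_eq_square algebra_simps)
  then show thesis
    using 2 by (intro that[of y "y + s * x"])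
      (simp_all only: cong_iff_dvd_diff dvd_triv_left,
       simp_all add: t rotx_def roty_def algebra_simps)
next
  case 3
  define s where "s = t div 3"
  have t: "t = 3 * s + 2" using 3 by (simp add: s_def) presburger
  have "2 * t * y + t\<^sup>2 * x - (2 * (x - y) + t * x)
      = 3 * (2 * s * y + 2 * y + 3 * s\<^sup>2 * x + 3 * s * x)"
    by (simp add: t power2_eq_square algebra_simps)
  then show thesis
    using 3 by (intro that[of "x - y" "x + s * x"])
      (simp_all only: cong_iff_dvd_diff dvd_triv_left,
       simp_all add: t rotx_def roty_def algebra_simps)
qed

text \<open>The second coordinate modulo 3, where the twist \<open>3 * m\<close> disappears, gives
  the first relation. The first coordinate modulo 9, divided by 3, compares the pi^2 coefficients
  and gives the second.\<close>

lemma rot_commute_cong: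
  fixes t t' x x' y y' m :: int
  assumes "[x + rotx t x' y' = x' + rotx t' x y] (mod 9)"
    and "[y + roty t x' y' = y' + roty t' x y + 3 * m] (mod 9)"
  shows "[t * x' = t' * x] (mod 3)"
    and "[2 * t * y' + t\<^sup>2 * x' = 2 * t' * y + t'\<^sup>2 * x] (mod 3)"
proof -
  obtain p q where p: "rotx t x' y' = x' - 3 * p" and q: "roty t x' y' = y' + t * x' - 3 * q"
    and pt: "[2 * t * y' + t\<^sup>2 * x' = 2 * p + t * x'] (mod 3)"
    by (rule rot_expansion)
  obtain p' q' where p': "rotx t' x y = x - 3 * p'" and q': "roty t' x y = y + t' * x - 3 * q'"
    and pt': "[2 * t' * y + t'\<^sup>2 * x = 2 * p' + t' * x] (mod 3)"
    by (rule rot_expansion)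
  have "9 dvd 3 * p' - 3 * p" using assms(1) by (simp add: p p' cong_iff_dvd_diff)
  then have pp': "[p = p'] (mod 3)" unfolding cong_iff_dvd_diff by presburger
  have "[t * x' - t' * x = 3 * (m + q - q')] (mod 9)"
    using assms(2) by (simp add: q q' cong_iff_dvd_diff algebra_simps)
  then have "3 dvd (t * x' - t' * x) - 3 * (m + q - q')"
    unfolding cong_iff_dvd_diff by (rule dvd_trans[rotated]) simp
  from dvd_add[OF this dvd_triv_left[of 3 "m + q - q'"]] have "3 dvd t * x' - t' * x"
    by (simp only: diff_add_cancel)
  then show tx: "[t * x' = t' * x] (mod 3)" by (simp add: cong_iff_dvd_diff)
  have "[2 * p + t * x' = 2 * p' + t' * x] (mod 3)"
    by (intro cong_add cong_mult cong_refl pp' tx)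
  then show "[2 * t * y' + t\<^sup>2 * x' = 2 * t' * y + t'\<^sup>2 * x] (mod 3)"
    by (rule cong_trans[OF cong_trans[OF pt] cong_sym[OF pt']])
qed

text \<open>The Heisenberg coordinates \<open>b\<close> and \<open>c\<close> are \<open>x\<close>
  and \<open>y\<close> modulo 3; the carries of \<open>x\<close> and \<open>y\<close> modulo 9 play
  the roles of \<open>d\<close> and \<open>h\<close>. The central element 3 pi is (omega - 1) 3, the
  commutator of omega with the vector 3, and equals -6 pi, the commutator of 1 and pi.\<close>

lemma bogomolov_nontrivial_eisenstein:
  "bogomolov_nontrivial (reduced_group eisenstein_red eisenstein_mult (0, 0, 0))"
proof -
  have mod9: "[a mod 9 = a] (mod 3)" for a :: int by (simp add: cong_def mod_mod_cancel)
  have comm: "[x + rotx t x' y' = x' + rotx t' x y] (mod 9)"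
    "[y + roty t x' y' = y' + roty t' x y
       + 3 * (x * roty t x' y' - y * rotx t x' y' - (x' * roty t' x y - y' * rotx t' x y))] (mod 9)"
    if "eisenstein_red (eisenstein_mult (t, x, y) (t', x', y'))
      = eisenstein_red (eisenstein_mult (t', x', y') (t, x, y))"
    for t x y t' x' y'
    using that
    by (simp_all add: eisenstein_red_def eisenstein_mult_def cong_iff_dvd_diff mod_eq_dvd_iff
        algebra_simps)
  show ?thesis
  proof (rule heisenberg_criterion[where p = 3 and t = fst and b = "fst \<circ> snd" and c = "snd \<circ> snd"
        and x = "eisenstein_red (0, 1, 0)" and y = "eisenstein_red (0, 0, 1)" and z = "eisenstein_red (0, 0, 3)"
        and u = "eisenstein_red (1, 0, 0)" and v = "eisenstein_red (0, 3, 0)"], goal_cases)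
    case 1
    show ?case by (rule group_eisenstein)
  next
    case (4 v w)
    then show ?case
      by (cases v; cases w) (simp add: eisenstein_red_def eisenstein_mult_def cong_def)
  next
    case (5 v w)
    obtain t x y where v: "v = (t, x, y)" by (cases v)
    obtain t' x' y' where w: "w = (t', x', y')" by (cases w)
    have "[x + rotx t x' y' = x + x'] (mod 3)"
      by (auto simp: rotx_def cong_iff_dvd_diff)
    then show ?case using cong_trans[OF mod9] by (simp add: v w eisenstein_red_def eisenstein_mult_def)
  next
    case (6 v w)
    obtain t x y where v: "v = (t, x, y)" by (cases v)
    obtain t' x' y' where w: "w = (t', x', y')" by (cases w)
    have "[roty t x' y' = y' + (t mod 3) * x'] (mod 3)"
      by (cases t rule: mod3_cases) (simp_all add: roty_def cong_iff_dvd_diff)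
    moreover have "[y' + (t mod 3) * x' = y' + t * x'] (mod 3)"
      by (intro cong_add cong_mult cong_refl) simp
    ultimately have "[roty t x' y' = y' + t * x'] (mod 3)" by (rule cong_trans)
    then have "[y + roty t x' y' - 3 * (x * roty t x' y' - y * rotx t x' y')
        = y + (y' + t * x') - 0] (mod 3)"
      by (intro cong_add cong_diff cong_refl) (simp_all add: cong_0_iff)
    then have "[y + roty t x' y' - 3 * (x * roty t x' y' - y * rotx t x' y') = y + y' + t * x'] (mod 3)"
      by (simp only: diff_zero add.assoc)
    then show ?case using cong_trans[OF mod9] by (simp add: v w eisenstein_red_def eisenstein_mult_def)
  next
    case (7 v w)
    obtain t x y where v: "v = (t, x, y)" by (cases v)
    obtain t' x' y' where w: "w = (t', x', y')" by (cases w)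
    have "eisenstein_red (eisenstein_mult (t, x, y) (t', x', y'))
        = eisenstein_red (eisenstein_mult (t', x', y') (t, x, y))"
      using 7 v w by simp
    from rot_commute_cong(1)[OF comm[OF this]] show ?case by (simp add: v w)
  next
    case (8 v w)
    obtain t x y where v: "v = (t, x, y)" by (cases v)
    obtain t' x' y' where w: "w = (t', x', y')" by (cases w)
    have "eisenstein_red (eisenstein_mult (t, x, y) (t', x', y'))
        = eisenstein_red (eisenstein_mult (t', x', y') (t, x, y))"
      using 8 v w by simp
    from rot_commute_cong(2)[OF comm[OF this]] show ?case by (simp add: v w)
  next
    case (9 v w)
    obtain t x y where v: "v = (t, x, y)" by (cases v)
    obtain t' x' y' where w: "w = (t', x', y')" by (cases w)
    have "eisenstein_red (eisenstein_mult (t, x, y) (t', x', y'))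
        = eisenstein_red (eisenstein_mult (t', x', y') (t, x, y))"
      using 9 v w by simp
    moreover have "t mod 3 = 0" "t' mod 3 = 0" using 9 v w by simp_all
    ultimately have "9 dvd 6 * (y * x' - x * y')"
      using comm(2)[of t x y t' x' y']
      by (simp add: rotx_def roty_def cong_iff_dvd_diff algebra_simps)
    moreover have "3 dvd m" if "9 dvd 6 * m" for m :: int using that by presburger
    ultimately have "3 dvd y * x' - x * y'" by blast
    then show ?case by (simp add: v w cong_iff_dvd_diff dvd_diff_commute mult.commute)
  next
    case 10
    show ?case by simp
  qed (auto simp: eisenstein_red_def eisenstein_mult_def rotx_def roty_def cong_def)
qed

subsection \<open>The group of order $2^6$\<close>

text \<open>The semidirect product $C_8 \rtimes D_4$. A triple $(a, g, n)$ modulo $2$ is an element of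
  $D_4$, with $n$ its central coordinate; its generators $a$ and $g$ act on $C_8$ by $-1$ and
  by $5$. The cocycle is the cup product of the parities of $g$ and $i$.\<close>

definition dih_act :: "int \<Rightarrow> int \<Rightarrow> int" where
  "dih_act a g = (if even a then 1 else - 1) * (if even g then 1 else 5)"

definition dih_mult :: "int \<times> int \<times> int \<times> int \<Rightarrow> int \<times> int \<times> int \<times> int \<Rightarrow> int \<times> int \<times> int \<times> int" where
  "dih_mult = (\<lambda>(i, a, g, n) (i', a', g', n').
     (i + dih_act a g * i', a + a', g + g', n + n' + a * g'))"

definition dih_red :: "int \<times> int \<times> int \<times> int \<Rightarrow> int \<times> int \<times> int \<times> int" where
  "dih_red = (\<lambda>(i, a, g, n). (i mod 8, a mod 2, g mod 2, n mod 2))"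

lemma even_mod2_iff: "even (a mod 2) \<longleftrightarrow> even (a :: int)"
  by presburger

lemma dih_act_mod [simp]: "dih_act (a mod 2) (g mod 2) = dih_act a g"
  by (simp add: dih_act_def even_mod2_iff)

lemma dih_act_add: "[dih_act (a + a') (g + g') = dih_act a g * dih_act a' g'] (mod 8)"
  by (auto simp: dih_act_def cong_iff_dvd_diff)

lemma dih_mult_cong: "dih_red (dih_mult (dih_red v) (dih_red w)) = dih_red (dih_mult v w)"
  by (cases v; cases w)
    (auto simp: dih_red_def dih_mult_def mod_simps simp flip: cong_def
      intro!: cong_add cong_mult)

lemma group_dih: "group (reduced_group dih_red dih_mult (0, 0, 0, 0))"
proof (rule group_reduced_group[where
      i = "\<lambda>(i, a, g, n). (- dih_act a g * i, - a, - g, - n + a * g)"])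
  show "dih_red (dih_mult (dih_mult u v) w) = dih_red (dih_mult u (dih_mult v w))" for u v w
  proof -
    obtain i a g n where u: "u = (i, a, g, n)" by (cases u)
    obtain i' a' g' n' where v: "v = (i', a', g', n')" by (cases v)
    obtain i'' a'' g'' n'' where w: "w = (i'', a'', g'', n'')" by (cases w)
    have "[i + dih_act a g * i' + dih_act (a + a') (g + g') * i''
        = i + dih_act a g * i' + (dih_act a g * dih_act a' g') * i''] (mod 8)"
      by (intro cong_add cong_mult cong_refl dih_act_add)
    then show ?thesis
      by (simp add: u v w dih_red_def dih_mult_def cong_def algebra_simps)
  qed
qed (auto simp: dih_mult_cong, auto simp: dih_red_def dih_mult_def dih_act_def)

lemma order_dih:
  defines "G \<equiv> reduced_group dih_red dih_mult (0, 0, 0, 0)"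
  shows "finite (carrier G)" "order G = 64"
proof -
  have "range dih_red = {0..<8} \<times> {0..<2} \<times> {0..<2} \<times> {0..<2}" (is "_ = ?C")
  proof (intro equalityI subsetI)
    show "x \<in> ?C" if "x \<in> range dih_red" for x using that by (auto simp: dih_red_def)
    show "x \<in> range dih_red" if "x \<in> ?C" for x
      using that by (intro range_eqI[of _ _ x]) (auto simp: dih_red_def)
  qed
  then show "finite (carrier G)" "order G = 64"
    by (simp_all add: G_def order_def card_cartesian_product)
qed

text \<open>Commutation in D_4 determines the parity of \<open>a'\<close> from those of
  \<open>a\<close> and \<open>g'\<close>, hence the action of the second element. What remains is
  \<open>dih_act a g - 1\<close>, which is 4 or -6, times an odd number, and 8 does not divide it.
  With C_2 x C_2 in place of D_4 the claim fails: the triples (2, 0, 1) and (1, 1, 0) for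
  \<open>(i, a, g)\<close> would commute.\<close>

lemma dih_commute_parity:
  assumes eq: "dih_red (dih_mult (i, a, g, n) (i', a', g', n'))
      = dih_red (dih_mult (i', a', g', n') (i, a, g, n))"
    and "odd g" "odd i'"
  shows "odd i \<and> odd g'"
proof (rule ccontr)
  assume neg: "\<not> (odd i \<and> odd g')"
  have i: "8 dvd i + dih_act a g * i' - (i' + dih_act a' g' * i)"
    and "2 dvd a * g' - a' * g"
    using eq by (simp_all add: dih_red_def dih_mult_def mod_eq_dvd_iff algebra_simps)
  then have parity: "even (a * g') \<longleftrightarrow> even a'" using \<open>odd g\<close> by simp
  have no: False if "8 dvd (dih_act a g - 1) * m" "odd m" for m
  proof -
    have "\<not> 8 dvd 4 * m" "\<not> 8 dvd 6 * m" using \<open>odd m\<close> by presburger+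
    then show False using that(1) \<open>odd g\<close> by (simp add: dih_act_def split: if_splits)
  qed
  show False
  proof (cases "even g'")
    case True
    then have "8 dvd (dih_act a g - 1) * i'"
      using i parity by (simp add: dih_act_def algebra_simps)
    then show False using \<open>odd i'\<close> by (rule no)
  next
    case False
    then have "dih_act a' g' = dih_act a g" using parity \<open>odd g\<close> by (simp add: dih_act_def)
    then have "8 dvd (dih_act a g - 1) * (i' - i)"
      using i by (simp add: algebra_simps)
    moreover have "odd (i' - i)" using neg False \<open>odd i'\<close> by simp
    ultimately show False by (rule no)
  qed
qed

lemma bogomolov_nontrivial_dih:
  "bogomolov_nontrivial (reduced_group dih_red dih_mult (0, 0, 0, 0))" (is "bogomolov_nontrivial ?G")
proof -
  define \<beta> \<gamma> :: "int \<times> int \<times> int \<times> int \<Rightarrow> bool"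
    where "\<beta> = (\<lambda>(i, a, g, n). odd i)" and "\<gamma> = (\<lambda>(i, a, g, n). odd g)"
  define f :: "int \<times> int \<times> int \<times> int \<Rightarrow> int \<times> int \<times> int \<times> int \<Rightarrow> rat"
    where "f = (\<lambda>v w. if \<gamma> v \<and> \<beta> w then 1 / 2 else 0)"
  have \<beta>: "\<beta> (v \<otimes>\<^bsub>?G\<^esub> w) \<longleftrightarrow> \<beta> v \<noteq> \<beta> w" and \<gamma>: "\<gamma> (v \<otimes>\<^bsub>?G\<^esub> w) \<longleftrightarrow> \<gamma> v \<noteq> \<gamma> w" for v w
  proof -
    have "even (m mod 8) \<longleftrightarrow> even m" for m :: int by presburger
    then show "\<beta> (v \<otimes>\<^bsub>?G\<^esub> w) \<longleftrightarrow> \<beta> v \<noteq> \<beta> w" "\<gamma> (v \<otimes>\<^bsub>?G\<^esub> w) \<longleftrightarrow> \<gamma> v \<noteq> \<gamma> w"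
      by (cases v; cases w;
          auto simp: \<beta>_def \<gamma>_def dih_red_def dih_mult_def dih_act_def even_mod2_iff)+
  qed
  have "cocycle2 ?G f"
    unfolding cocycle2_def
  proof (intro ballI)
    fix g h k
    show "f g h + f (g \<otimes>\<^bsub>?G\<^esub> h) k - f g (h \<otimes>\<^bsub>?G\<^esub> k) - f h k \<in> \<int>"
      unfolding f_def \<beta> \<gamma>
      by (cases "\<gamma> g"; cases "\<gamma> h"; cases "\<beta> h"; cases "\<beta> k") simp_all
  qed
  moreover have "\<not> coboundary2_on ?G (carrier ?G) f"
  proof (rule not_coboundary2_onI[OF group_dih])
    \<comment> \<open>The element 4 of C_8 is a commutator twice: 5 - 1 with \<open>g\<close> acting
      on 1, and -2 - 2 with \<open>a\<close> acting on 2. Only the first pair is seen by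
      \<open>f\<close>.\<close>
    show "{dih_red (0, 0, 1, 0), dih_red (1, 0, 0, 0), dih_red (4, 0, 0, 0),
        dih_red (0, 1, 0, 0), dih_red (2, 0, 0, 0)} \<subseteq> carrier ?G"
      by simp
  qed (auto simp: dih_red_def dih_mult_def dih_act_def f_def \<beta>_def \<gamma>_def elim!: Ints_cases)
  moreover have "coboundary2_on ?G A f"
    if comm: "\<And>v w. v \<in> A \<Longrightarrow> w \<in> A \<Longrightarrow> v \<otimes>\<^bsub>?G\<^esub> w = w \<otimes>\<^bsub>?G\<^esub> v" for A
  proof -
    have key: "\<beta> v \<and> \<gamma> w" if "v \<in> A" "w \<in> A" "\<gamma> v" "\<beta> w" for v w
    proof -
      obtain i a g n where v: "v = (i, a, g, n)" by (cases v)
      obtain i' a' g' n' where w: "w = (i', a', g', n')" by (cases w)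
      have "odd i \<and> odd g'"
      proof (rule dih_commute_parity)
        show "dih_red (dih_mult (i, a, g, n) (i', a', g', n'))
            = dih_red (dih_mult (i', a', g', n') (i, a, g, n))"
          using comm[OF that(1,2)] by (simp add: v w)
      qed (use that v w in \<open>simp_all add: \<beta>_def \<gamma>_def\<close>)
      then show ?thesis by (simp add: v w \<beta>_def \<gamma>_def)
    qed
    show ?thesis
    proof (cases "\<exists>v\<in>A. \<gamma> v \<and> \<not> \<beta> v")
      case True
      then have "\<not> \<beta> w" if "w \<in> A" for w using key that by blast
      then show ?thesis
        unfolding coboundary2_on_def by (intro exI[of _ "\<lambda>_. 0"]) (simp add: f_def)
    next
      case False
      \<comment> \<open>If \<open>\<gamma>\<close> occurs in \<open>A\<close>, then
        \<open>\<beta>\<close> and \<open>\<gamma>\<close> now agree on \<open>A\<close>, so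
        \<open>f\<close> is 1/2 times the product of \<open>\<gamma>\<close> with itself; otherwise
        \<open>f\<close> vanishes. The value 1/4 works because twice it is 1/2.\<close>
      define c :: "int \<times> int \<times> int \<times> int \<Rightarrow> rat" where "c = (\<lambda>v. if \<gamma> v then 1 / 4 else 0)"
      have "f v w - (c v + c w - c (v \<otimes>\<^bsub>?G\<^esub> w)) = 0" if "v \<in> A" "w \<in> A" for v w
        using key[OF that] \<gamma>[of v w] False that by (auto simp: f_def c_def)
      then show ?thesis
        unfolding coboundary2_on_def by (intro exI[of _ c]) simp
    qed
  qed
  ultimately show ?thesis by (intro bogomolov_nontrivialI) auto
qed

section \<open>Multiples of 2^6 and p^5\<close>

theorem theorem1p13:
  fixes n :: nat
  assumes "n > 0"
    and "2 ^ 6 dvd n \<or> (\<exists>p::nat. Factorial_Ring.prime p \<and> odd p \<and> p ^ 5 dvd n)"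
  shows "\<exists>G :: nat monoid. group G \<and> finite (carrier G) \<and> order G = n \<and>
           bogomolov_nontrivial G"
  using assms(2)
proof (elim disjE exE conjE)
  assume "2 ^ 6 dvd n"
  then obtain k where n: "n = 64 * k" by (auto elim: dvdE)
  then have "k > 0" using assms(1) by simp
  from bogomolov_nontrivial_nat_multiple[OF group_dih order_dih bogomolov_nontrivial_dih this]
  show ?thesis unfolding n .
next
  fix p :: nat
  assume p: "Factorial_Ring.prime p" "odd p" and "p ^ 5 dvd n"
  then obtain k where n: "n = p ^ 5 * k" by (auto elim: dvdE)
  then have "k > 0" using assms(1) by (cases k) auto
  show ?thesis
  proof (cases "p = 3")
    case True
    then have n': "n = 243 * k" using n by simp
    from bogomolov_nontrivial_nat_multiple[OF group_eisenstein order_eisenstein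
        bogomolov_nontrivial_eisenstein \<open>k > 0\<close>]
    show ?thesis unfolding n' .
  next
    case False
    have "p \<noteq> 2" using p by auto
    then have "p > 3" using False prime_ge_2_nat[OF p(1)] by simp
    then have "Factorial_Ring.prime (int p)" "int p > 3" "p > 0" using p by simp_all
    note p' = this
    from bogomolov_nontrivial_nat_multiple[OF group_shift order_shift[OF p'(3)]
        bogomolov_nontrivial_shift[OF p'(1,2)] \<open>k > 0\<close>]
    show ?thesis unfolding n .
  qed
qed

end
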